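(* Let $\theta>0$, let $W_1,W_2,\ldots$ be i.i.d. with beta$(1,\theta)$ density $\theta(1-w)^{\theta-1}$ on $(0,1)$, let $P_i:=(1-W_1)\cdots(1-W_{i-1})W_i$ (so $P=(P_1,P_2,\ldots)$ has the GEM$(\theta)$ distribution), and let $\Pi$ be a $P$-biased permutation of $\mathbb{N}_{+}$. Let $u_n$ be the probability that $\Pi$ maps $[n]$ onto $[n]$, and $u_\infty:=\lim_{n\to\infty}u_n$. Then $$u_\infty=\frac1{1+\theta}\prod_{j=2}^\infty\frac{j(j+2\theta)}{(j+\theta)^2}=\frac{\Gamma(\theta+2)\,\Gamma(\theta+1)}{\Gamma(2\theta+2)}.$$ In particular, for $\theta=1$, $u_\infty=1/3$.
   Context: $\mathbb{N}_{+}=\{1,2,\ldots\}$, $[n]=\{1,\ldots,n\}$, and $\Gamma$ is the gamma function. **$P$-biased permutation:** conditionally given the random probability distribution $P$ on $\mathbb{N}_{+}$ (all $P_i>0$), let $X_1,X_2,\ldots$ be i.i.d. with distribution $P$; then $\Pi=(\Pi_1,\Pi_2,\ldots)$ is the sequence of distinct values of $(X_1,X_2,\ldots)$ in order of appearance, regarded as the permutation $i\mapsto\Pi_i$ of $\mathbb{N}_{+}$. *)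

theory Defs
  imports "HOL-Probability.Probability"
begin

text \<open>
  Sequences indexed by the positive integers are functions on \<^typ>\<open>nat\<close> of which only the values at
  arguments \<open>i \<ge> 1\<close> matter.
\<close>

definition beta_1_density :: "real \<Rightarrow> real \<Rightarrow> real" where
  "beta_1_density \<theta> w = \<theta> * (1 - w) powr (\<theta> - 1) * indicator {0<..<1} w"

definition stick_breaking :: "(nat \<Rightarrow> 'a \<Rightarrow> real) \<Rightarrow> nat \<Rightarrow> 'a \<Rightarrow> real" where
  "stick_breaking W i \<omega> = (\<Prod>j\<in>{1..<i}. 1 - W j \<omega>) * W i \<omega>"

text \<open>The sigma-algebra on \<^term>\<open>space M\<close> generated by the whole sequence \<open>P\<^sub>1, P\<^sub>2, \<dots>\<close>.\<close>

definition sigma_of_seq :: "'a measure \<Rightarrow> (nat \<Rightarrow> 'a \<Rightarrow> real) \<Rightarrow> 'a measure" where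
  "sigma_of_seq M P =
     vimage_algebra (space M) (\<lambda>\<omega>. \<lambda>i\<in>{1..}. P i \<omega>) (\<Pi>\<^sub>M i\<in>{1..}. borel)"

text \<open>
  Conditionally given \<open>P\<close>, the variables \<open>X\<^sub>1, X\<^sub>2, \<dots>\<close> are i.i.d. with distribution \<open>P\<close>. As they are
  discrete, their conditional law is given by the conditional probabilities of the events
  \<open>X\<^sub>1 = k\<^sub>1, \<dots>, X\<^sub>n = k\<^sub>n\<close>.
\<close>

definition cond_iid_sample ::
  "'a measure \<Rightarrow> (nat \<Rightarrow> 'a \<Rightarrow> real) \<Rightarrow> (nat \<Rightarrow> 'a \<Rightarrow> nat) \<Rightarrow> bool" where
  "cond_iid_sample M P X \<longleftrightarrow>
     (\<forall>i\<ge>1. X i \<in> M \<rightarrow>\<^sub>M count_space {1..}) \<and>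
     (\<forall>n. \<forall>k\<in>{1..n} \<rightarrow> {1..}. AE \<omega> in M.
        real_cond_exp M (sigma_of_seq M P)
          (indicator {\<omega>\<in>space M. \<forall>i\<in>{1..n}. X i \<omega> = k i}) \<omega>
        = (\<Prod>i\<in>{1..n}. P (k i) \<omega>))"

definition first_appearance_times :: "(nat \<Rightarrow> nat) \<Rightarrow> nat set" where
  "first_appearance_times x = {i. 1 \<le> i \<and> (\<forall>j\<in>{1..<i}. x j \<noteq> x i)}"

text \<open>
  The \<open>i\<close>-th distinct value of \<open>x\<^sub>1, x\<^sub>2, \<dots>\<close> in order of appearance; \<^const>\<open>enumerate\<close> counts from \<open>0\<close>.
  If \<open>x\<close> takes only finitely many values, the dummy value \<open>0\<close> is used; for a sample from a distribution
  charging every positive integer this happens with probability \<open>0\<close>.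
\<close>

definition distinct_value :: "(nat \<Rightarrow> nat) \<Rightarrow> nat \<Rightarrow> nat" where
  "distinct_value x i =
     (if infinite (first_appearance_times x)
      then x (enumerate (first_appearance_times x) (i - 1)) else 0)"

definition biased_permutation ::
  "'a measure \<Rightarrow> (nat \<Rightarrow> 'a \<Rightarrow> real) \<Rightarrow> (nat \<Rightarrow> 'a \<Rightarrow> nat) \<Rightarrow> bool" where
  "biased_permutation M P Perm \<longleftrightarrow>
     (\<exists>X. cond_iid_sample M P X \<and>
          (\<forall>i\<ge>1. \<forall>\<omega>\<in>space M. Perm i \<omega> = distinct_value (\<lambda>j. X j \<omega>) i))"

definition prob_maps_onto :: "'a measure \<Rightarrow> (nat \<Rightarrow> 'a \<Rightarrow> nat) \<Rightarrow> nat \<Rightarrow> real" where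
  "prob_maps_onto M Perm n = measure M {\<omega>\<in>space M. (\<lambda>i. Perm i \<omega>) ` {1..n} = {1..n}}"

end

theory Submission
  imports Defs "HOL-Real_Asymp.Real_Asymp"
begin

text \<open>
  The permutation maps \<open>[n]\<close> onto \<open>[n]\<close> exactly when every value in \<open>[n]\<close> is sampled before the first
  value exceeding \<open>n\<close>. For \<open>0 \<le> j \<le> n\<close> let \<open>Z\<^sub>j\<close> be the number of values greater than \<open>j\<close> that are sampled
  before the first value exceeding \<open>n\<close>, so that \<open>Z\<^sub>n = 0\<close>. Among the values greater than \<open>j - 1\<close>,
  the value \<open>j\<close> occurs with probability \<open>W\<^sub>j\<close>; hence, given \<open>W\<^sub>j\<close> and \<open>Z\<^sub>j = k\<close>, the number of
  occurrences of \<open>j\<close>, which is \<open>Z\<^sub>j\<^sub>-\<^sub>1 - k\<close>, has a negative binomial distribution. Averaging over the beta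
  variable \<open>W\<^sub>j\<close> shows that \<open>Z\<^sub>n, Z\<^sub>n\<^sub>-\<^sub>1, \<dots>, Z\<^sub>0\<close> is a Markov chain started at \<open>0\<close> that jumps from \<open>k\<close> to \<open>k + m\<close> with
  a probability \<open>q(k, m)\<close> not depending on \<open>j\<close> or \<open>n\<close> (\<open>jump_prob\<close>). Therefore
  \<open>u\<^sub>n = h\<^sub>n(0)\<close>, where \<open>h\<^sub>n(k)\<close> (\<open>strict_prob\<close>) is the probability that this chain, started at \<open>k\<close>,
  makes \<open>n\<close> strictly positive jumps in a row.

  The chain itself is never constructed. Instead the event is split according to the word of values sampled
  before the first value exceeding \<open>n\<close>: the probability of a word is a product of beta moments
  (\<open>stick_breaking_word_expectation\<close>), and the sum over all words obeys the recursion for \<open>h\<^sub>n\<close>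
  (\<open>word_weight_sum\<close>), because a word over the letters \<open>\<ge> j\<close> is a shuffle of a word over the
  letters \<open>> j\<close> with a block of letters \<open>j\<close>, and the binomial coefficient counts the shuffles.

  The limit comes from an explicit harmonic function of the chain killed at its first zero jump,
  \<open>H(k) = \<Gamma>(k + \<theta> + 1) \<Gamma>(k + \<theta> + 2) / (k! \<Gamma>(k + 2\<theta> + 2))\<close> (\<open>strict_limit\<close>). It satisfies
  \<open>H(k) = \<Sum>\<^sub>m\<^sub>\<ge>\<^sub>1 q(k, m) H(k + m)\<close>, by a telescoping sum, and it increases to \<open>1\<close>. Since \<open>n\<close> strictly positive jumps
  lead from \<open>k\<close> to at least \<open>k + n\<close>, induction gives \<open>H(k) \<le> h\<^sub>n(k) \<le> H(k) / H(k + n)\<close>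
  (\<open>strict_prob_bounds\<close>), so \<open>u\<^sub>n \<longlonglongrightarrow> H(0)\<close>, which is the asserted quotient of gamma values. The infinite product is
  the limit of \<open>H(0) / H(n)\<close> written as a product of successive ratios.
\<close>

section \<open>The killed Markov chain and its harmonic function\<close>

text \<open>
  The moment \<open>E(W\<^sup>m (1 - W)\<^bsup>k + 1\<^esup>)\<close> of a beta\<open>(1, \<theta>)\<close> variable \<open>W\<close>; see \<open>beta_1_moment\<close> below.
\<close>
definition stick_moment :: "real \<Rightarrow> nat \<Rightarrow> nat \<Rightarrow> real" where
  "stick_moment \<theta> m k = \<theta> * Beta (real m + 1) (real k + \<theta> + 1)"

text \<open>
  The probability that the chain jumps from \<open>k\<close> to \<open>k + m\<close>: before the \<open>(k + 1)\<close>-st failure of trials with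
  success probability \<open>W\<close> there are exactly \<open>m\<close> successes, averaged over \<open>W\<close>.
\<close>
definition jump_prob :: "real \<Rightarrow> nat \<Rightarrow> nat \<Rightarrow> real" where
  "jump_prob \<theta> k m = real ((k + m) choose m) * stick_moment \<theta> m k"

text \<open>
  The probability that the chain started at \<open>k\<close> makes \<open>n\<close> strictly positive jumps in a row. The values are
  extended nonnegative reals, so that the defining series needs no proof of convergence.
\<close>
primrec strict_prob :: "real \<Rightarrow> nat \<Rightarrow> nat \<Rightarrow> ennreal" where
  "strict_prob \<theta> 0 k = 1"
| "strict_prob \<theta> (Suc n) k =
     (\<Sum>m. ennreal (jump_prob \<theta> k (Suc m)) * strict_prob \<theta> n (k + Suc m))"

text \<open>
  The probability that the chain started at \<open>k\<close> never makes a zero jump, in closed form.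
\<close>
definition strict_limit :: "real \<Rightarrow> nat \<Rightarrow> real" where
  "strict_limit \<theta> k = Gamma (real k + \<theta> + 1) * Gamma (real k + \<theta> + 2) /
     (Gamma (real k + 1) * Gamma (real k + 2 * \<theta> + 2))"

lemma Gamma_real_add_1: "x > 0 \<Longrightarrow> Gamma (x + 1) = x * Gamma (x::real)"
  by (subst Gamma_plus1) (auto elim!: nonpos_Ints_cases)

lemma stick_moment_nonneg: "\<theta> > 0 \<Longrightarrow> stick_moment \<theta> m k \<ge> 0"
  by (auto simp: stick_moment_def Beta_def intro!: mult_nonneg_nonneg divide_nonneg_nonneg less_imp_le[OF Gamma_real_pos])

lemma jump_prob_nonneg: "\<theta> > 0 \<Longrightarrow> jump_prob \<theta> k m \<ge> 0"
  by (simp add: jump_prob_def stick_moment_nonneg)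

lemma strict_limit_pos: "\<theta> > 0 \<Longrightarrow> strict_limit \<theta> k > 0"
  by (auto simp: strict_limit_def intro!: divide_pos_pos mult_pos_pos Gamma_real_pos)

lemma strict_limit_Suc:
  assumes "\<theta> > 0"
  shows "strict_limit \<theta> (Suc k) =
    strict_limit \<theta> k * ((real k + \<theta> + 1) * (real k + \<theta> + 2)) / ((real k + 1) * (real k + 2 * \<theta> + 2))"
proof -
  have "Gamma (real (Suc k) + \<theta> + 1) = (real k + \<theta> + 1) * Gamma (real k + \<theta> + 1)"
    "Gamma (real (Suc k) + \<theta> + 2) = (real k + \<theta> + 2) * Gamma (real k + \<theta> + 2)"
    "Gamma (real (Suc k) + 1) = (real k + 1) * Gamma (real k + 1)"
    "Gamma (real (Suc k) + 2 * \<theta> + 2) = (real k + 2 * \<theta> + 2) * Gamma (real k + 2 * \<theta> + 2)"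
    using assms by (subst Gamma_real_add_1 [symmetric]; simp add: algebra_simps)+
  then show ?thesis
    by (simp add: strict_limit_def mult_ac)
qed

lemma strict_limit_mono:
  assumes "\<theta> > 0" "k \<le> l"
  shows "strict_limit \<theta> k \<le> strict_limit \<theta> l"
proof (rule lift_Suc_mono_le[OF _ assms(2)])
  fix k
  have "(real k + 1) * (real k + 2 * \<theta> + 2) \<le> (real k + \<theta> + 1) * (real k + \<theta> + 2)"
    using assms(1) by (simp add: algebra_simps)
  then show "strict_limit \<theta> k \<le> strict_limit \<theta> (Suc k)"
    using assms(1) strict_limit_pos[OF assms(1), of k]
    by (subst strict_limit_Suc) (auto simp: divide_simps)
qed

text \<open>
  The asymptotics \<open>\<Gamma>(n + a) \<sim> n! n\<^bsup>a - 1\<^esup>\<close>, a restatement of Gauss's limit for the gamma function.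
\<close>
lemma Gamma_shift_over_powr:
  assumes "(a::real) > 0"
  shows "(\<lambda>n. Gamma (real n + a) / (fact n * real n powr (a - 1))) \<longlonglongrightarrow> 1"
proof -
  have G0: "Gamma a > 0" using assms by (rule Gamma_real_pos)
  have nonpos: "a \<notin> \<int>\<^sub>\<le>\<^sub>0" using assms by (auto elim!: nonpos_Ints_cases)
  have "(\<lambda>n. (Gamma a / Gamma_series a n) * (real n / (real n + a))) \<longlonglongrightarrow> (Gamma a / Gamma a) * 1"
  proof (intro tendsto_intros)
    show "Gamma a \<noteq> 0" using G0 by simp
    show "(\<lambda>n. real n / (real n + a)) \<longlonglongrightarrow> 1" by real_asymp
  qed
  moreover have "eventually (\<lambda>n. (Gamma a / Gamma_series a n) * (real n / (real n + a))
      = Gamma (real n + a) / (fact n * real n powr (a - 1))) sequentially"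
    using eventually_gt_at_top[of 0]
  proof eventually_elim
    case (elim n)
    have p: "Gamma (a + real (Suc n)) = pochhammer a (Suc n) * Gamma a"
      using pochhammer_Gamma[OF nonpos, of "Suc n"] less_imp_neq[OF G0] by (simp add: field_simps)
    have q: "Gamma (a + real (Suc n)) = (real n + a) * Gamma (real n + a)"
      using Gamma_real_add_1[of "real n + a"] assms by (simp add: add_ac)
    have r: "exp (a * ln (real n)) = real n powr (a - 1) * real n"
      using elim by (simp add: powr_def exp_diff algebra_simps)
    have "pochhammer a (Suc n) > 0" using assms by (rule pochhammer_pos)
    moreover have "x / (f * (u * v) / c) * (v / w) = g / (f * u)"
      if "c * x = w * g" "f > 0" "u > 0" "v > 0" "w > 0" for x f u v w c g :: real
      using that by (simp add: field_simps)
    ultimately show ?case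
      using elim assms p q r by (simp add: Gamma_series_def)
  qed
  ultimately show ?thesis
    using G0 by (simp add: tendsto_cong)
qed

lemma strict_limit_tendsto:
  assumes "\<theta> > 0"
  shows "strict_limit \<theta> \<longlonglongrightarrow> 1"
proof -
  define g where "g a n = Gamma (real n + a) / (fact n * real n powr (a - 1))" for a n
  have g: "g a \<longlonglongrightarrow> 1" if "a > 0" for a
    unfolding g_def using Gamma_shift_over_powr[OF that] .
  have "(\<lambda>n. g (\<theta> + 1) n * g (\<theta> + 2) n / (g 1 n * g (2 * \<theta> + 2) n)) \<longlonglongrightarrow> 1 * 1 / (1 * 1)"
    using assms by (intro tendsto_intros g) auto
  moreover have "eventually (\<lambda>n. g (\<theta> + 1) n * g (\<theta> + 2) n / (g 1 n * g (2 * \<theta> + 2) n)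
      = strict_limit \<theta> n) sequentially"
    using eventually_gt_at_top[of 0]
  proof eventually_elim
    case (elim n)
    have "real n powr \<theta> * real n powr (\<theta> + 1) = real n powr (2 * \<theta> + 1)"
      by (simp flip: powr_add)
    then show ?case
      using elim by (simp add: g_def strict_limit_def add_ac)
  qed
  ultimately show ?thesis by (simp add: tendsto_cong)
qed

lemma Gamma_ratio_tendsto_0:
  assumes "(0::real) < a" "a < b"
  shows "(\<lambda>n. Gamma (real n + a) / Gamma (real n + b)) \<longlonglongrightarrow> 0"
proof -
  define g where "g a n = Gamma (real n + a) / (fact n * real n powr (a - 1))" for a n
  have g: "g a \<longlonglongrightarrow> 1" if "a > 0" for a
    unfolding g_def using Gamma_shift_over_powr[OF that] .
  have "(\<lambda>n. g a n / g b n * real n powr (a - b)) \<longlonglongrightarrow> 1 / 1 * 0"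
  proof (intro tendsto_mult tendsto_divide g)
    show "(\<lambda>n. real n powr (a - b)) \<longlonglongrightarrow> 0"
      using assms by (intro tendsto_neg_powr filterlim_real_sequentially) auto
  qed (use assms in auto)
  moreover have "eventually (\<lambda>n. g a n / g b n * real n powr (a - b)
      = Gamma (real n + a) / Gamma (real n + b)) sequentially"
    using eventually_gt_at_top[of 0]
  proof eventually_elim
    case (elim n)
    have "real n powr (a - 1) = real n powr (a - b) * real n powr (b - 1)"
      by (simp flip: powr_add)
    then show ?case
      using elim by (simp add: g_def)
  qed
  ultimately show ?thesis by (simp add: tendsto_cong)
qed

text \<open>
  With \<open>G(r) = \<Gamma>(r + \<theta> + 2) / \<Gamma>(r + 2\<theta> + 2)\<close>, the \<open>m\<close>-th term of the series is a constant times
  \<open>G(k + m) - G(k + m + 1)\<close>.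
\<close>
lemma strict_limit_harmonic:
  assumes "\<theta> > 0"
  shows "(\<lambda>m. jump_prob \<theta> k (Suc m) * strict_limit \<theta> (k + Suc m)) sums strict_limit \<theta> k"
proof -
  define a where "a = Gamma (real k + \<theta> + 1) / fact k"
  define G where "G r = Gamma (real r + (\<theta> + 2)) / Gamma (real r + (2 * \<theta> + 2))" for r
  have incr: "jump_prob \<theta> k (Suc m) * strict_limit \<theta> (k + Suc m) = a * (G (k + m) - G (Suc (k + m)))" for m
  proof -
    define r where "r = k + m"
    have binom: "real ((k + Suc m) choose Suc m) = fact (Suc r) / (fact (Suc m) * fact k)"
      by (subst binomial_fact) (auto simp: r_def)
    have pos: "Gamma (real r + \<theta> + 2) > 0" "Gamma (real r + 2 * \<theta> + 2) > 0" "Gamma (real k + \<theta> + 1) > 0"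
      "Gamma (real r + \<theta> + 3) > 0" "Gamma (real r + 2 * \<theta> + 3) > 0"
      using assms by (auto intro!: Gamma_real_pos)
    have e1: "Gamma (real r + \<theta> + 3) = (real r + \<theta> + 2) * Gamma (real r + \<theta> + 2)"
      using Gamma_real_add_1[of "real r + \<theta> + 2"] assms by (simp add: add_ac)
    have e2: "Gamma (real r + 2 * \<theta> + 3) = (real r + 2 * \<theta> + 2) * Gamma (real r + 2 * \<theta> + 2)"
      using Gamma_real_add_1[of "real r + 2 * \<theta> + 2"] assms by (simp add: add_ac)
    have f1: "Gamma (real (Suc m) + 1) = fact (Suc m)" "Gamma (real (Suc r) + 1) = fact (Suc r)"
      using Gamma_fact[of "Suc m", where ?'a = real] Gamma_fact[of "Suc r", where ?'a = real]
      by (simp_all add: add_ac)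
    have s: "stick_moment \<theta> (Suc m) k = \<theta> * fact (Suc m) * Gamma (real k + \<theta> + 1) / Gamma (real r + \<theta> + 3)"
    proof -
      have arg: "real (Suc m) + 1 + (real k + \<theta> + 1) = real r + \<theta> + 3" by (simp add: r_def)
      then show ?thesis unfolding stick_moment_def Beta_def f1 arg by simp
    qed
    have h: "strict_limit \<theta> (k + Suc m) = Gamma (real r + \<theta> + 2) * Gamma (real r + \<theta> + 3) /
        (fact (Suc r) * Gamma (real r + 2 * \<theta> + 3))"
    proof -
      have "k + Suc m = Suc r" by (simp add: r_def)
      moreover have "real (Suc r) + \<theta> + 1 = real r + \<theta> + 2" "real (Suc r) + \<theta> + 2 = real r + \<theta> + 3"
        "real (Suc r) + 2 * \<theta> + 2 = real r + 2 * \<theta> + 3" by simp_all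
      ultimately show ?thesis unfolding strict_limit_def by (simp only: f1)
    qed
    have "jump_prob \<theta> k (Suc m) * strict_limit \<theta> (k + Suc m)
        = a * (\<theta> * Gamma (real r + \<theta> + 2) / Gamma (real r + 2 * \<theta> + 3))"
      unfolding jump_prob_def binom s h a_def using pos
      by (simp add: field_simps del: fact_Suc)
    also have "\<theta> * Gamma (real r + \<theta> + 2) / Gamma (real r + 2 * \<theta> + 3) = G r - G (Suc r)"
    proof -
      have "G r = Gamma (real r + \<theta> + 2) / Gamma (real r + 2 * \<theta> + 2)"
        "G (Suc r) = Gamma (real r + \<theta> + 3) / Gamma (real r + 2 * \<theta> + 3)"
        by (simp_all add: G_def add_ac)
      moreover have "x / y - u * x / (v * y) = (v - u) * x / (v * y)" if "y > 0" "v > 0" for x y u v :: real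
        using that by (simp add: field_simps)
      moreover have "real r + 2 * \<theta> + 2 > 0" using assms by simp
      ultimately show ?thesis using pos(2) by (simp add: e1 e2)
    qed
    finally show ?thesis by (simp add: r_def)
  qed
  have "G \<longlonglongrightarrow> 0"
    unfolding G_def using assms by (intro Gamma_ratio_tendsto_0) auto
  then have "(\<lambda>m. G (m + k)) \<longlonglongrightarrow> 0" by (rule LIMSEQ_ignore_initial_segment)
  from telescope_sums'[OF this] have "(\<lambda>m. a * (G (k + m) - G (Suc (k + m)))) sums (a * (G k - 0))"
    by (intro sums_mult) (simp add: add_ac)
  moreover have "a * (G k - 0) = strict_limit \<theta> k"
    using Gamma_fact[of k, where ?'a = real]
    by (simp add: a_def G_def strict_limit_def add_ac)
  ultimately show ?thesis by (simp only: incr)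
qed

lemma strict_prob_bounds:
  assumes "\<theta> > 0"
  shows "ennreal (strict_limit \<theta> k) \<le> strict_prob \<theta> n k"
    and "strict_prob \<theta> n k \<le> ennreal (strict_limit \<theta> k / strict_limit \<theta> (k + n))"
proof -
  note nn = jump_prob_nonneg[OF assms] strict_limit_pos[OF assms]
  have harm: "(\<Sum>m. ennreal (jump_prob \<theta> k (Suc m)) * ennreal (strict_limit \<theta> (k + Suc m) / c)) = ennreal (strict_limit \<theta> k / c)"
    if "c > 0" for k c
    unfolding ennreal_mult'[OF nn(1), symmetric]
  proof (rule suminf_ennreal_eq)
    show "(\<lambda>m. jump_prob \<theta> k (Suc m) * (strict_limit \<theta> (k + Suc m) / c)) sums (strict_limit \<theta> k / c)"
      using sums_divide[OF strict_limit_harmonic[OF assms, of k], of c] by (simp del: add_Suc_right)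
  qed (use nn that in \<open>auto intro!: mult_nonneg_nonneg divide_nonneg_pos intro: less_imp_le\<close>)
  have le1: "strict_limit \<theta> k \<le> 1" for k
    using strict_limit_tendsto[OF assms] strict_limit_mono[OF assms]
    by (intro incseq_le) (auto simp: incseq_def)
  show "ennreal (strict_limit \<theta> k) \<le> strict_prob \<theta> n k"
  proof (induction n arbitrary: k)
    case (Suc n)
    have "ennreal (strict_limit \<theta> k) = (\<Sum>m. ennreal (jump_prob \<theta> k (Suc m)) * ennreal (strict_limit \<theta> (k + Suc m)))"
      using harm[of 1 k] by simp
    also have "\<dots> \<le> strict_prob \<theta> (Suc n) k"
      unfolding strict_prob.simps by (intro suminf_le mult_left_mono Suc) auto
    finally show ?case .
  qed (use le1 in auto)
  show "strict_prob \<theta> n k \<le> ennreal (strict_limit \<theta> k / strict_limit \<theta> (k + n))"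
  proof (induction n arbitrary: k)
    case 0
    then show ?case using nn(2)[of k] by simp
  next
    case (Suc n)
    have "strict_prob \<theta> (Suc n) k \<le>
        (\<Sum>m. ennreal (jump_prob \<theta> k (Suc m)) * ennreal (strict_limit \<theta> (k + Suc m) / strict_limit \<theta> (k + Suc n)))"
      unfolding strict_prob.simps
    proof (intro suminf_le mult_left_mono)
      fix m
      have "strict_prob \<theta> n (k + Suc m) \<le> ennreal (strict_limit \<theta> (k + Suc m) / strict_limit \<theta> (k + Suc m + n))"
        by (rule Suc)
      also have "\<dots> \<le> ennreal (strict_limit \<theta> (k + Suc m) / strict_limit \<theta> (k + Suc n))"
        by (intro ennreal_leI divide_left_mono strict_limit_mono[OF assms] mult_pos_pos nn nn(2)[THEN less_imp_le]) auto
      finally show "strict_prob \<theta> n (k + Suc m) \<le> \<dots>" .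
    qed auto
    also have "\<dots> = ennreal (strict_limit \<theta> k / strict_limit \<theta> (k + Suc n))"
      by (rule harm[OF nn(2)])
    finally show ?case .
  qed
qed

lemma strict_prob_tendsto:
  assumes "\<theta> > 0"
  shows "(\<lambda>n. enn2real (strict_prob \<theta> n k)) \<longlonglongrightarrow> strict_limit \<theta> k"
proof (rule tendsto_sandwich)
  note b = strict_prob_bounds[OF assms, where k = k]
  have fin: "strict_prob \<theta> n k < top" for n
    using b(2)[of n] by (rule order_le_less_trans) simp
  show "eventually (\<lambda>n. strict_limit \<theta> k \<le> enn2real (strict_prob \<theta> n k)) sequentially"
    using enn2real_mono[OF b(1) fin] less_imp_le[OF strict_limit_pos[OF assms]] by simp
  show "eventually (\<lambda>n. enn2real (strict_prob \<theta> n k) \<le> strict_limit \<theta> k / strict_limit \<theta> (k + n)) sequentially"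
    using b(2) strict_limit_pos[OF assms]
    by (intro always_eventually allI enn2real_leI) (auto intro!: divide_nonneg_pos less_imp_le)
  have "(\<lambda>n. strict_limit \<theta> (n + k)) \<longlonglongrightarrow> 1"
    using strict_limit_tendsto[OF assms] by (rule LIMSEQ_ignore_initial_segment)
  then have "(\<lambda>n. strict_limit \<theta> k / strict_limit \<theta> (k + n)) \<longlonglongrightarrow> strict_limit \<theta> k / 1"
    by (intro tendsto_intros) (auto simp: add_ac)
  then show "(\<lambda>n. strict_limit \<theta> k / strict_limit \<theta> (k + n)) \<longlonglongrightarrow> strict_limit \<theta> k" by simp
qed simp

text \<open>
  The ratio \<open>H(0) / H(n)\<close> is the product over \<open>k < n\<close> of
  \<open>(k + 1) (k + 2 + 2\<theta>) / ((k + 1 + \<theta>) (k + 2 + \<theta>))\<close>. The factors \<open>(k + 1) / (k + 1 + \<theta>)\<close> are one index behind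
  those of the product on the left; this accounts for the boundary factors \<open>1 + \<theta>\<close> and \<open>(n + 1) / (n + 1 + \<theta>)\<close>.
\<close>
lemma strict_limit_prod:
  assumes "\<theta> > 0"
  shows "(\<Prod>j<n. real (j + 2) * (real (j + 2) + 2 * \<theta>) / (real (j + 2) + \<theta>)\<^sup>2)
    = (1 + \<theta>) * strict_limit \<theta> 0 / strict_limit \<theta> n * ((real n + 1) / (real n + 1 + \<theta>))"
proof (induction n)
  case 0
  then show ?case using assms strict_limit_pos[OF assms, of 0] by (simp add: add_ac)
next
  case (Suc n)
  define x where "x = real n"
  have x: "x \<ge> 0" by (simp add: x_def)
  have e: "(x + 1) / (x + 1 + \<theta>) * ((x + 2) * (x + 2 + 2 * \<theta>) / (x + 2 + \<theta>)\<^sup>2)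
     = ((x + 1) * (x + 2 * \<theta> + 2)) / ((x + \<theta> + 1) * (x + \<theta> + 2)) * ((x + 2) / (x + 2 + \<theta>))"
    using x assms by (simp add: power2_eq_square add_ac mult_ac)
  have H: "strict_limit \<theta> n > 0" by (rule strict_limit_pos[OF assms])
  have "(1 + \<theta>) * strict_limit \<theta> 0 / strict_limit \<theta> n * ((x + 1) / (x + 1 + \<theta>) * ((x + 2) * (x + 2 + 2 * \<theta>) / (x + 2 + \<theta>)\<^sup>2))
     = (1 + \<theta>) * strict_limit \<theta> 0 / strict_limit \<theta> (Suc n) * ((x + 2) / (x + 2 + \<theta>))"
    unfolding e strict_limit_Suc[OF assms] x_def using H by (simp add: power2_eq_square mult_ac add_ac)
  with Suc show ?case by (simp add: x_def add_ac mult_ac)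
qed

lemma strict_limit_infinite_product:
  assumes "\<theta> > 0"
  defines "f \<equiv> \<lambda>j. real (j + 2) * (real (j + 2) + 2 * \<theta>) / (real (j + 2) + \<theta>)\<^sup>2"
  shows "convergent_prod f" and "strict_limit \<theta> 0 = 1 / (1 + \<theta>) * prodinf f"
proof -
  have "(\<lambda>n. (1 + \<theta>) * strict_limit \<theta> 0 / strict_limit \<theta> n * ((real n + 1) / (real n + 1 + \<theta>)))
      \<longlonglongrightarrow> (1 + \<theta>) * strict_limit \<theta> 0 / 1 * 1"
  proof (intro tendsto_mult tendsto_divide tendsto_const strict_limit_tendsto[OF assms(1)])
    show "(\<lambda>n. (real n + 1) / (real n + 1 + \<theta>)) \<longlonglongrightarrow> 1" by real_asymp
  qed auto
  then have "(\<lambda>n. prod f {..<n}) \<longlonglongrightarrow> (1 + \<theta>) * strict_limit \<theta> 0"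
    unfolding f_def strict_limit_prod[OF assms(1)] by simp
  then have lim: "(\<lambda>n. prod f {..n}) \<longlonglongrightarrow> (1 + \<theta>) * strict_limit \<theta> 0"
    using LIMSEQ_Suc unfolding lessThan_Suc_atMost [symmetric] by blast
  have "f j \<noteq> 0" for j
    using assms(1) by (simp add: f_def add_nonneg_eq_0_iff)
  then show conv: "convergent_prod f"
    using lim assms(1) strict_limit_pos[OF assms(1), of 0] by (subst convergent_prod_iff_nz_lim) force+
  have "prodinf f = (1 + \<theta>) * strict_limit \<theta> 0"
    using LIMSEQ_unique[OF convergent_prod_LIMSEQ[OF conv] lim] .
  then show "strict_limit \<theta> 0 = 1 / (1 + \<theta>) * prodinf f"
    using assms(1) by simp
qed

section \<open>Sums over words\<close>

text \<open>
  For a word \<open>w\<close> over \<open>[n]\<close>, the probability that the sample starts with \<open>w\<close> and continues with a value exceeding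
  \<open>n\<close>. It is the expectation of a product to which the value \<open>i\<close> contributes a factor \<open>W\<^sub>i\<close> for each of its occurrences and a factor \<open>1 - W\<^sub>i\<close> for each
  greater value, including the final one exceeding \<open>n\<close>.
\<close>
definition word_weight :: "real \<Rightarrow> nat \<Rightarrow> nat list \<Rightarrow> real" where
  "word_weight \<theta> n w =
     (\<Prod>i\<in>{1..n}. stick_moment \<theta> (count_list w i) (length (filter (\<lambda>j. i < j) w)))"

text \<open>
  The words of positive integers that contain every letter of \<open>[n]\<close> and whose subword of letters greater than \<open>n\<close> is \<open>v\<close>.
\<close>
definition words_over :: "nat \<Rightarrow> nat list \<Rightarrow> nat list set" where
  "words_over n v = {w. filter (\<lambda>j. n < j) w = v \<and> {1..n} \<subseteq> set w \<and> 0 \<notin> set w}"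

lemma nn_integral_count_space_fibres:
  assumes "\<And>x. x \<in> A \<Longrightarrow> g x \<in> B"
  shows "(\<integral>\<^sup>+x. f x \<partial>count_space A)
    = (\<integral>\<^sup>+y. (\<integral>\<^sup>+x. f x \<partial>count_space {x \<in> A. g x = y}) \<partial>count_space B)"
proof -
  define h where "h = (\<lambda>(x, y). f x * indicator A x * indicator {g x} y)"
  have "(\<integral>\<^sup>+x. f x \<partial>count_space A) = (\<integral>\<^sup>+x. f x * indicator A x \<partial>count_space UNIV)"
    by (subst nn_integral_count_space_indicator) auto
  also have "\<dots> = (\<integral>\<^sup>+x. \<integral>\<^sup>+y. h (x, y) \<partial>count_space UNIV \<partial>count_space UNIV)"
    by (simp add: h_def nn_integral_cmult)
  also have "\<dots> = (\<integral>\<^sup>+y. \<integral>\<^sup>+x. h (x, y) \<partial>count_space UNIV \<partial>count_space UNIV)"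
    unfolding nn_integral_fst_count_space nn_integral_snd_count_space ..
  also have "\<dots> = (\<integral>\<^sup>+y. (\<integral>\<^sup>+x. f x \<partial>count_space {x \<in> A. g x = y}) * indicator B y \<partial>count_space UNIV)"
  proof (intro nn_integral_cong)
    fix y
    have "(\<integral>\<^sup>+x. f x \<partial>count_space {x \<in> A. g x = y}) * indicator B y
        = (\<integral>\<^sup>+x. f x \<partial>count_space {x \<in> A. g x = y})"
    proof (cases "y \<in> B")
      case False
      then have empty: "{x \<in> A. g x = y} = {}" using assms by auto
      show ?thesis unfolding empty by (simp add: nn_integral_count_space_finite)
    qed simp
    also have "\<dots> = (\<integral>\<^sup>+x. h (x, y) \<partial>count_space UNIV)"
      by (subst nn_integral_count_space_indicator) (auto simp: h_def indicator_def intro!: nn_integral_cong)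
    finally show "(\<integral>\<^sup>+x. h (x, y) \<partial>count_space UNIV)
      = (\<integral>\<^sup>+x. f x \<partial>count_space {x \<in> A. g x = y}) * indicator B y" ..
  qed
  also have "\<dots> = (\<integral>\<^sup>+y. (\<integral>\<^sup>+x. f x \<partial>count_space {x \<in> A. g x = y}) \<partial>count_space B)"
    by (subst nn_integral_count_space_indicator[of B]) auto
  finally show ?thesis .
qed

lemma shuffles_replicate_iff:
  fixes n :: nat
  assumes "\<forall>x\<in>set v. n < x"
  shows "u \<in> shuffles v (replicate m n) \<longleftrightarrow>
    filter (\<lambda>j. n < j) u = v \<and> count_list u n = m \<and> set u \<subseteq> {n..}"
proof
  assume u: "u \<in> shuffles v (replicate m n)"
  have "partition (\<lambda>j. n < j) -` {(v, replicate m n)} = shuffles v (replicate m n)"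
    using assms by (intro inv_image_partition) auto
  with u have p: "filter (\<lambda>j. n < j) u = v" "filter (\<lambda>j. \<not> n < j) u = replicate m n"
    by (auto simp: o_def)
  have s: "set u \<subseteq> {n..}" using set_shuffles[OF u] assms by (auto split: if_splits)
  have "count_list u n = length (filter (\<lambda>j. \<not> n < j) u)"
    using s by (induction u) auto
  with p s show "filter (\<lambda>j. n < j) u = v \<and> count_list u n = m \<and> set u \<subseteq> {n..}" by simp
next
  assume u: "filter (\<lambda>j. n < j) u = v \<and> count_list u n = m \<and> set u \<subseteq> {n..}"
  then have "set u \<subseteq> {n..}" by simp
  then have "filter (\<lambda>j. \<not> n < j) u = replicate (count_list u n) n"
    by (induction u) auto
  with u show "u \<in> shuffles v (replicate m n)"
    using partition_in_shuffles[of u "\<lambda>j. n < j"] by simp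
qed

text \<open>
  The sum over all ways to insert the letters \<open>n, n - 1, \<dots>, 1\<close> into \<open>v\<close> depends on \<open>v\<close> only through its length.
  Inserting \<open>m \<ge> 1\<close> copies of the letter \<open>n\<close> first corresponds to the first jump, of size \<open>m\<close>, of the chain.
\<close>
lemma word_weight_sum:
  assumes "\<theta> > 0" "\<forall>x\<in>set v. n < x"
  shows "(\<integral>\<^sup>+w. ennreal (word_weight \<theta> n w) \<partial>count_space (words_over n v))
    = strict_prob \<theta> n (length v)"
  using assms(2)
proof (induction n arbitrary: v)
  case 0
  have "filter (\<lambda>j. 0 < j) w = w" if "0 \<notin> set w" for w :: "nat list"
    using that by (intro filter_True) (metis gr0I)
  moreover have "0 \<notin> set v" using 0 by auto
  ultimately have "words_over 0 v = {v}"
    unfolding words_over_def by auto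
  then show ?case
    by (simp add: nn_integral_count_space_finite word_weight_def)
next
  case (Suc n)
  let ?N = "Suc n"
  \<comment> \<open>The words in which the letter \<open>n + 1\<close> occurs \<open>m\<close> times, fibred over their subwords of letters \<open>> n\<close>.\<close>
  define C where "C m = {w \<in> words_over ?N v. count_list w ?N = m}" for m
  have fibre: "{w \<in> C m. filter (\<lambda>j. n < j) w = u} = words_over n u"
    if u: "u \<in> shuffles v (replicate m ?N)" and m: "m > 0" for u m
  proof -
    from u have f: "filter (\<lambda>j. ?N < j) u = v" "count_list u ?N = m"
      using Suc.prems by (auto simp: shuffles_replicate_iff)
    have cnt: "count_list (filter (\<lambda>j. n < j) w) ?N = count_list w ?N" for w
      by (induction w) auto
    have flt: "filter (\<lambda>j. ?N < j) (filter (\<lambda>j. n < j) w) = filter (\<lambda>j. ?N < j) w" for w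
      unfolding filter_filter by (rule filter_cong) auto
    have "w \<in> C m" if "w \<in> words_over n u" for w
    proof -
      have w: "filter (\<lambda>j. n < j) w = u" "{1..n} \<subseteq> set w" "0 \<notin> set w"
        using that by (auto simp: words_over_def)
      have c: "count_list w ?N = m" using cnt[of w] f w by simp
      then have "?N \<in> set w" using m count_notin by fastforce
      moreover have "{1..?N} = insert ?N {1..n}" by auto
      ultimately show ?thesis
        using w c f flt[of w] by (simp add: C_def words_over_def)
    qed
    moreover have "{1..n} \<subseteq> {1..?N}" by auto
    ultimately show ?thesis by (auto simp: C_def words_over_def)
  qed
  have level: "(\<integral>\<^sup>+w. ennreal (word_weight \<theta> ?N w) \<partial>count_space (C m))
      = ennreal (jump_prob \<theta> (length v) m) * strict_prob \<theta> n (length v + m)" if m: "m > 0" for m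
  proof -
    let ?S = "shuffles v (replicate m ?N)"
    have w_eq: "ennreal (word_weight \<theta> ?N w) = ennreal (stick_moment \<theta> m (length v)) * ennreal (word_weight \<theta> n w)"
      if "w \<in> C m" for w
    proof -
      have "word_weight \<theta> ?N w = stick_moment \<theta> m (length v) * word_weight \<theta> n w"
        using that by (simp add: C_def words_over_def word_weight_def)
      then show ?thesis
        by (simp add: ennreal_mult' stick_moment_nonneg[OF assms(1)])
    qed
    have "(\<integral>\<^sup>+w. ennreal (word_weight \<theta> ?N w) \<partial>count_space (C m))
        = (\<integral>\<^sup>+w. ennreal (stick_moment \<theta> m (length v)) * ennreal (word_weight \<theta> n w) \<partial>count_space (C m))"
      by (intro nn_integral_cong w_eq) simp
    also have "\<dots> = ennreal (stick_moment \<theta> m (length v)) * (\<integral>\<^sup>+w. ennreal (word_weight \<theta> n w) \<partial>count_space (C m))"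
      by (rule nn_integral_cmult) simp
    also have "(\<integral>\<^sup>+w. ennreal (word_weight \<theta> n w) \<partial>count_space (C m))
        = (\<integral>\<^sup>+u. (\<integral>\<^sup>+w. ennreal (word_weight \<theta> n w) \<partial>count_space {w \<in> C m. filter (\<lambda>j. n < j) w = u}) \<partial>count_space ?S)"
    proof (rule nn_integral_count_space_fibres)
      fix w assume w: "w \<in> C m"
      have "count_list (filter (\<lambda>j. n < j) w) ?N = count_list w ?N"
        by (induction w) auto
      moreover have "filter (\<lambda>j. ?N < j) (filter (\<lambda>j. n < j) w) = filter (\<lambda>j. ?N < j) w"
        unfolding filter_filter by (rule filter_cong) auto
      ultimately show "filter (\<lambda>j. n < j) w \<in> ?S"
        using w Suc.prems by (auto simp: shuffles_replicate_iff C_def words_over_def)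
    qed
    also have "\<dots> = (\<integral>\<^sup>+u. strict_prob \<theta> n (length v + m) \<partial>count_space ?S)"
    proof (intro nn_integral_cong)
      fix u assume "u \<in> space (count_space ?S)"
      then have u: "u \<in> ?S" by simp
      have "\<forall>x\<in>set u. n < x" using set_shuffles[OF u] Suc.prems by (auto split: if_splits)
      from Suc.IH[OF this] show "(\<integral>\<^sup>+w. ennreal (word_weight \<theta> n w) \<partial>count_space {w \<in> C m. filter (\<lambda>j. n < j) w = u})
          = strict_prob \<theta> n (length v + m)"
        using fibre[OF u m] length_shuffles[OF u] by simp
    qed
    also have "\<dots> = of_nat ((length v + m) choose m) * strict_prob \<theta> n (length v + m)"
    proof -
      have "set v \<inter> set (replicate m ?N) = {}" using Suc.prems by auto
      then have "card ?S = (length v + m) choose m"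
        using binomial_symmetric[of "length v" "length v + m"] by (simp add: card_disjoint_shuffles)
      then show ?thesis by (simp add: nn_integral_count_space_finite mult.commute)
    qed
    finally show ?thesis
      by (simp add: jump_prob_def ennreal_mult stick_moment_nonneg[OF assms(1)] mult_ac flip: ennreal_of_nat_eq_real_of_nat)
  qed
  \<comment> \<open>The letter \<open>n + 1\<close> must occur, so the index \<open>m\<close> counts its occurrences minus one.\<close>
  have "(\<integral>\<^sup>+w. ennreal (word_weight \<theta> ?N w) \<partial>count_space (words_over ?N v))
      = (\<integral>\<^sup>+m. (\<integral>\<^sup>+w. ennreal (word_weight \<theta> ?N w) \<partial>count_space {w \<in> words_over ?N v. count_list w ?N - 1 = m}) \<partial>count_space UNIV)"
    by (rule nn_integral_count_space_fibres) simp
  also have "\<dots> = (\<Sum>m. \<integral>\<^sup>+w. ennreal (word_weight \<theta> ?N w) \<partial>count_space (C (Suc m)))"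
    unfolding nn_integral_count_space_nat
  proof (intro suminf_cong)
    fix m
    have "count_list w ?N > 0" if "w \<in> words_over ?N v" for w
    proof -
      have "?N \<in> {1..?N}" by simp
      then have "?N \<in> set w" using that unfolding words_over_def by blast
      then show ?thesis using count_list_0_iff[of w ?N] by simp
    qed
    then have "{w \<in> words_over ?N v. count_list w ?N - 1 = m} = C (Suc m)"
      by (fastforce simp: C_def)
    then show "(\<integral>\<^sup>+w. ennreal (word_weight \<theta> ?N w) \<partial>count_space {w \<in> words_over ?N v. count_list w ?N - 1 = m})
      = (\<integral>\<^sup>+w. ennreal (word_weight \<theta> ?N w) \<partial>count_space (C (Suc m)))" by simp
  qed
  also have "\<dots> = strict_prob \<theta> ?N (length v)"
    by (simp add: level del: add_Suc_right)
  finally show ?case .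
qed

corollary word_weight_total:
  assumes "\<theta> > 0"
  shows "(\<integral>\<^sup>+w. ennreal (word_weight \<theta> n w) \<partial>count_space {w. set w = {1..n}}) = strict_prob \<theta> n 0"
proof -
  have "words_over n [] = {w. set w = {1..n}}"
    by (auto simp: words_over_def filter_empty_conv not_less Suc_le_eq) (metis gr0I)
  then show ?thesis
    using word_weight_sum[OF assms, of "[]" n] by simp
qed

section \<open>Distinct values in order of appearance\<close>

text \<open>
  The sequence \<open>x\<^sub>1, x\<^sub>2, \<dots>\<close> starts with the word \<open>w\<close>, in which exactly the values in \<open>[n]\<close> occur, and continues with a
  value outside \<open>[n]\<close>. Positions in the sequence start at \<open>1\<close>, those in the list at \<open>0\<close>.
\<close>
definition exhausting_word :: "nat \<Rightarrow> (nat \<Rightarrow> nat) \<Rightarrow> nat list \<Rightarrow> bool" where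
  "exhausting_word n x w \<longleftrightarrow> set w = {1..n} \<and> (\<forall>i\<in>{1..length w}. x i = w ! (i - 1)) \<and> x (length w + 1) \<notin> {1..n}"

lemma exhausting_word_unique:
  assumes "exhausting_word n x v" "exhausting_word n x w"
  shows "v = w"
proof -
  have le: "length w \<le> length v" if "exhausting_word n x v" "exhausting_word n x w" for v w
  proof (rule ccontr)
    assume "\<not> length w \<le> length v"
    then have "length v + 1 \<in> {1..length w}" by simp
    then have "x (length v + 1) = w ! length v" "w ! length v \<in> set w"
      using that(2) by (auto simp: exhausting_word_def)
    then show False using that by (auto simp: exhausting_word_def)
  qed
  then have len: "length v = length w" using assms by (metis le_antisym)
  show ?thesis
  proof (rule nth_equalityI[OF len])
    fix i assume "i < length v"
    then have "i + 1 \<in> {1..length v}" "i + 1 \<in> {1..length w}" using len by auto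
    then show "v ! i = w ! i"
      using assms unfolding exhausting_word_def by (metis add_diff_cancel_right')
  qed
qed

lemma image_first_appearance_times:
  "x ` (first_appearance_times x \<inter> {..<k}) = x ` {1..<k}"
proof
  show "x ` (first_appearance_times x \<inter> {..<k}) \<subseteq> x ` {1..<k}"
    by (auto simp: first_appearance_times_def)
  show "x ` {1..<k} \<subseteq> x ` (first_appearance_times x \<inter> {..<k})"
  proof
    fix y assume "y \<in> x ` {1..<k}"
    then have "\<exists>i. 1 \<le> i \<and> i < k \<and> x i = y" by auto
    then obtain i where i: "1 \<le> i" "i < k" "x i = y" and min: "\<And>j. j < i \<Longrightarrow> \<not> (1 \<le> j \<and> j < k \<and> x j = y)"
      using exists_least_iff[of "\<lambda>i. 1 \<le> i \<and> i < k \<and> x i = y"] by auto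
    then have "i \<in> first_appearance_times x" by (force simp: first_appearance_times_def)
    with i show "y \<in> x ` (first_appearance_times x \<inter> {..<k})" by auto
  qed
qed

lemma inj_on_first_appearance_times: "inj_on x (first_appearance_times x)"
proof (rule inj_onI)
  fix i j assume "i \<in> first_appearance_times x" "j \<in> first_appearance_times x" "x i = x j"
  then show "i = j"
    by (cases i j rule: linorder_cases) (auto simp: first_appearance_times_def)
qed

lemma enumerate_image_lessThan:
  fixes S :: "nat set"
  assumes "infinite S"
  shows "enumerate S ` {..<n} = S \<inter> {..<enumerate S n}"
proof
  show "S \<inter> {..<enumerate S n} \<subseteq> enumerate S ` {..<n}"
  proof
    fix s assume s: "s \<in> S \<inter> {..<enumerate S n}"
    then obtain m where "enumerate S m = s" using enumerate_Ex[OF assms] by blast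
    with s assms show "s \<in> enumerate S ` {..<n}" by auto
  qed
qed (use assms in \<open>auto simp: enumerate_in_set\<close>)

lemma distinct_value_onto_iff:
  assumes inf: "infinite (first_appearance_times x)"
  shows "distinct_value x ` {1..n} = {1..n} \<longleftrightarrow> (\<exists>w. exhausting_word n x w)"
proof -
  define F where "F = first_appearance_times x"
  define e where "e = enumerate F"
  have F: "infinite F" using inf by (simp add: F_def)
  have eF: "e n \<in> F" for n unfolding e_def using F by (rule enumerate_in_set)
  have e1: "e n \<ge> 1" for n using eF[of n] by (simp add: F_def first_appearance_times_def)
  have e_img: "e ` {..<n} = F \<inter> {..<e n}" for n
    unfolding e_def by (rule enumerate_image_lessThan[OF F])
  have "(\<lambda>i. i - 1) ` {1..n} = {..<n}" by (force simp: image_iff intro: bexI[of _ "Suc _"])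
  then have "x ` e ` {..<n} = (\<lambda>i. x (e (i - 1))) ` {1..n}"
    by (metis image_image)
  also have "\<dots> = distinct_value x ` {1..n}"
    using inf by (simp add: distinct_value_def F_def e_def)
  finally have "distinct_value x ` {1..n} = x ` e ` {..<n}"
    by simp
  then have img: "distinct_value x ` {1..n} = x ` {1..<e n}"
    using e_img image_first_appearance_times[of x "e n"] by (simp add: F_def)
  show ?thesis
  proof
    assume onto: "distinct_value x ` {1..n} = {1..n}"
    \<comment> \<open>The word ends just before the first appearance of the \<open>(n + 1)\<close>-st distinct value.\<close>
    define w where "w = map x [1..<e n]"
    have len: "length w + 1 = e n" using e1[of n] by (simp add: w_def)
    have "x (e n) \<notin> x ` {1..<e n}"
      using eF[of n] by (auto simp: F_def first_appearance_times_def)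
    then have "exhausting_word n x w"
      using onto img len unfolding exhausting_word_def by (auto simp: w_def)
    then show "\<exists>w. exhausting_word n x w" ..
  next
    assume "\<exists>w. exhausting_word n x w"
    then obtain w where w: "set w = {1..n}" "\<And>i. i \<in> {1..length w} \<Longrightarrow> x i = w ! (i - 1)" "x (length w + 1) \<notin> {1..n}"
      by (auto simp: exhausting_word_def)
    define t where "t = length w + 1"
    have xw: "x ` {1..<t} = {1..n}"
    proof -
      have "x ` {1..<t} = (\<lambda>i. w ! (i - 1)) ` {1..<t}"
        by (intro image_cong refl w) (auto simp: t_def)
      also have "\<dots> = (\<lambda>i. w ! i) ` {..<length w}"
        by (force simp: t_def image_iff intro: bexI[of _ "Suc _"])
      also have "\<dots> = set w" by (auto simp: set_conv_nth)
      finally show ?thesis using w by simp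
    qed
    \<comment> \<open>The position \<open>t\<close> just after the word is a first appearance, preceded by exactly \<open>n\<close> others.\<close>
    have "x t \<notin> x ` {1..<t}" unfolding xw using w(3) by (simp add: t_def)
    then have "x j \<noteq> x t" if "j \<in> {1..<t}" for j
      using that by (metis imageI)
    then have "t \<in> F"
      unfolding F_def first_appearance_times_def by (simp add: t_def)
    then obtain m where m: "e m = t" using enumerate_Ex[OF F] by (auto simp: e_def)
    have "inj e" unfolding e_def by (rule inj_enumerate[OF F])
    then have "m = card (e ` {..<m})" by (simp add: card_image inj_on_subset)
    also have "\<dots> = card (F \<inter> {..<t})" using e_img[of m] m by simp
    also have "\<dots> = card (x ` (F \<inter> {..<t}))"
      using inj_on_first_appearance_times[of x]
      by (intro card_image[symmetric]) (auto simp: F_def intro: inj_on_subset)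
    also have "\<dots> = n" using xw image_first_appearance_times[of x t] by (simp add: F_def)
    finally show "distinct_value x ` {1..n} = {1..n}" using img m xw by simp
  qed
qed

lemma infinite_first_appearance_times:
  assumes "\<And>m. \<exists>i\<ge>1. x i > m"
  shows "infinite (first_appearance_times x)"
proof
  assume fin: "finite (first_appearance_times x)"
  have "x ` {1..} \<subseteq> x ` first_appearance_times x"
  proof
    fix y assume "y \<in> x ` {1..}"
    then obtain i where "1 \<le> i" "x i = y" by auto
    then have "y \<in> x ` {1..<Suc i}" by auto
    then show "y \<in> x ` first_appearance_times x"
      unfolding image_first_appearance_times[symmetric] by auto
  qed
  then have "finite (x ` {1..})" by (rule finite_subset) (use fin in simp)
  then obtain m where "\<forall>y\<in>x ` {1..}. y \<le> m" using finite_nat_set_iff_bounded_le by auto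
  then show False using assms[of m] by force
qed

section \<open>Moments of stick-breaking products\<close>

lemma beta_1_density_nonneg: "\<theta> > 0 \<Longrightarrow> beta_1_density \<theta> x \<ge> 0"
  by (simp add: beta_1_density_def)

lemma has_bochner_integral_beta_1_moment:
  assumes "\<theta> > 0"
  shows "has_bochner_integral lborel (\<lambda>x. beta_1_density \<theta> x * (x ^ m * (1 - x) ^ Suc k)) (stick_moment \<theta> m k)"
proof (rule has_bochner_integral_nn_integral)
  let ?B = "Beta (real m + 1) (real k + \<theta> + 1)"
  have "((\<lambda>t. t powr (real m + 1 - 1) * (1 - t) powr (real k + \<theta> + 1 - 1)) has_integral ?B) {0<..<1}"
    using has_integral_Beta_real[of "real m + 1" "real k + \<theta> + 1"] assms
    by (simp add: has_integral_Icc_iff_Ioo)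
  from has_integral_mult_right[OF this, of \<theta>]
  have "((\<lambda>t. \<theta> * (t powr real m * (1 - t) powr (real k + \<theta>))) has_integral stick_moment \<theta> m k) {0<..<1}"
    by (simp add: stick_moment_def)
  from nn_integral_has_integral_lebesgue'[OF _ this]
  have "(\<integral>\<^sup>+t. ennreal (\<theta> * (t powr real m * (1 - t) powr (real k + \<theta>))) * indicator {0<..<1} t \<partial>lborel)
      = ennreal (stick_moment \<theta> m k)"
    using assms by simp
  also have "(\<integral>\<^sup>+t. ennreal (\<theta> * (t powr real m * (1 - t) powr (real k + \<theta>))) * indicator {0<..<1} t \<partial>lborel)
      = (\<integral>\<^sup>+t. ennreal (beta_1_density \<theta> t * (t ^ m * (1 - t) ^ Suc k)) \<partial>lborel)"
  proof (rule nn_integral_cong)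
    fix t :: real
    show "ennreal (\<theta> * (t powr real m * (1 - t) powr (real k + \<theta>))) * indicator {0<..<1} t
        = ennreal (beta_1_density \<theta> t * (t ^ m * (1 - t) ^ Suc k))"
    proof (cases "t \<in> {0<..<1}")
      case True
      then have "(1 - t) powr (real k + \<theta>) = (1 - t) powr (\<theta> - 1) * (1 - t) ^ Suc k"
        by (subst powr_realpow[symmetric]) (auto simp flip: powr_add simp: add_ac)
      with True show ?thesis
        by (simp add: beta_1_density_def powr_realpow mult_ac)
    qed (simp add: beta_1_density_def)
  qed
  finally show "(\<integral>\<^sup>+t. ennreal (beta_1_density \<theta> t * (t ^ m * (1 - t) ^ Suc k)) \<partial>lborel) = ennreal (stick_moment \<theta> m k)" .
  show "(\<lambda>x. beta_1_density \<theta> x * (x ^ m * (1 - x) ^ Suc k)) \<in> borel_measurable lborel"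
    unfolding beta_1_density_def by measurable
  show "AE x in lborel. 0 \<le> beta_1_density \<theta> x * (x ^ m * (1 - x) ^ Suc k)"
    using assms by (auto simp: beta_1_density_def split: split_indicator)
qed (rule stick_moment_nonneg[OF assms])

lemma beta_1_moment:
  assumes "\<theta> > 0" "distributed M lborel X (beta_1_density \<theta>)"
  shows "integrable M (\<lambda>\<omega>. X \<omega> ^ m * (1 - X \<omega>) ^ Suc k)"
    and "(\<integral>\<omega>. X \<omega> ^ m * (1 - X \<omega>) ^ Suc k \<partial>M) = stick_moment \<theta> m k"
proof -
  note * = has_bochner_integral_beta_1_moment[OF assms(1), of m k]
  have g: "(\<lambda>x::real. x ^ m * (1 - x) ^ Suc k) \<in> borel_measurable lborel" by measurable
  show "integrable M (\<lambda>\<omega>. X \<omega> ^ m * (1 - X \<omega>) ^ Suc k)"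
    using distributed_integrable[OF assms(2) g] * beta_1_density_nonneg[OF assms(1)]
    by (auto simp: has_bochner_integral_iff)
  show "(\<integral>\<omega>. X \<omega> ^ m * (1 - X \<omega>) ^ Suc k \<partial>M) = stick_moment \<theta> m k"
    using distributed_integral[OF assms(2) g] * beta_1_density_nonneg[OF assms(1)]
    by (auto simp: has_bochner_integral_iff)
qed

lemma beta_1_AE:
  assumes "distributed M lborel X (beta_1_density \<theta>)"
  shows "AE \<omega> in M. 0 < X \<omega> \<and> X \<omega> < 1"
proof -
  have X: "X \<in> borel_measurable M" using distributed_measurable[OF assms] by simp
  have "emeasure M (X -` (- {0<..<1}) \<inter> space M) = (\<integral>\<^sup>+x. ennreal (beta_1_density \<theta> x) * indicator (- {0<..<1}) x \<partial>lborel)"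
    by (rule distributed_emeasure[OF assms]) auto
  also have "\<dots> = 0"
    by (intro nn_integral_zero') (auto simp: beta_1_density_def split: split_indicator)
  finally have "X -` (- {0<..<1}) \<inter> space M \<in> null_sets M"
    using X by (intro null_setsI measurable_sets[OF X]) auto
  then show ?thesis
    by (rule AE_I') auto
qed

text \<open>
  Each stick length is written as a product over the same index set \<open>[n]\<close>, so that products of stick lengths
  can be regrouped by the index of \<open>W\<close>.
\<close>
lemma stick_breaking_as_prod:
  assumes "1 \<le> i" "i \<le> n"
  shows "stick_breaking W i \<omega> = (\<Prod>j\<in>{1..n}. if j < i then 1 - W j \<omega> else if j = i then W j \<omega> else 1)"
proof -
  have "{1..n} = {1..<i} \<union> ({i} \<union> {i<..n})" using assms by auto
  then have "(\<Prod>j\<in>{1..n}. if j < i then 1 - W j \<omega> else if j = i then W j \<omega> else 1)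
    = (\<Prod>j\<in>{1..<i}. if j < i then 1 - W j \<omega> else if j = i then W j \<omega> else 1) *
      ((\<Prod>j\<in>{i}. if j < i then 1 - W j \<omega> else if j = i then W j \<omega> else 1) *
       (\<Prod>j\<in>{i<..n}. if j < i then 1 - W j \<omega> else if j = i then W j \<omega> else 1))"
    by (simp only:) (subst prod.union_disjoint; (auto simp: prod.union_disjoint)[1])+
  then show ?thesis by (simp add: stick_breaking_def)
qed

lemma stick_breaking_remainder:
  "1 - (\<Sum>i\<in>{1..n}. stick_breaking W i \<omega>) = (\<Prod>j\<in>{1..n}. 1 - W j \<omega>)"
proof (induction n)
  case (Suc n)
  have "{1..<Suc n} = {1..n}" by auto
  then show ?case using Suc by (simp add: stick_breaking_def algebra_simps)
qed simp

lemma stick_breaking_word: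
  assumes "set w \<subseteq> {1..n}"
  shows "(\<Prod>i\<leftarrow>w. stick_breaking W i \<omega>) =
    (\<Prod>j\<in>{1..n}. W j \<omega> ^ count_list w j * (1 - W j \<omega>) ^ length (filter (\<lambda>i. j < i) w))"
  using assms
proof (induction w)
  case (Cons i w)
  then have "(\<Prod>i\<leftarrow>i # w. stick_breaking W i \<omega>) =
      (\<Prod>j\<in>{1..n}. (if j < i then 1 - W j \<omega> else if j = i then W j \<omega> else 1) *
        (W j \<omega> ^ count_list w j * (1 - W j \<omega>) ^ length (filter (\<lambda>i. j < i) w)))"
    by (simp add: stick_breaking_as_prod[of i n] prod.distrib)
  also have "\<dots> = (\<Prod>j\<in>{1..n}. W j \<omega> ^ count_list (i # w) j * (1 - W j \<omega>) ^ length (filter (\<lambda>i. j < i) (i # w)))"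
    by (rule prod.cong) auto
  finally show ?case .
qed simp

lemma (in prob_space) stick_breaking_word_expectation:
  assumes "\<theta> > 0" "indep_vars (\<lambda>_. borel) W {1..}"
    and "\<And>i. i \<ge> 1 \<Longrightarrow> distributed M lborel (W i) (beta_1_density \<theta>)"
    and "set w \<subseteq> {1..n}"
  shows "expectation (\<lambda>\<omega>. (\<Prod>i\<leftarrow>w. stick_breaking W i \<omega>) * (1 - (\<Sum>i\<in>{1..n}. stick_breaking W i \<omega>)))
    = word_weight \<theta> n w"
proof -
  define g where "g j x = x ^ count_list w j * (1 - x) ^ Suc (length (filter (\<lambda>i. j < i) w))" for j and x :: real
  have "(\<Prod>i\<leftarrow>w. stick_breaking W i \<omega>) * (1 - (\<Sum>i\<in>{1..n}. stick_breaking W i \<omega>)) = (\<Prod>j\<in>{1..n}. g j (W j \<omega>))" for \<omega>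
    unfolding stick_breaking_word[OF assms(4)] stick_breaking_remainder g_def
    by (simp add: prod.distrib mult_ac)
  moreover have "expectation (\<lambda>\<omega>. \<Prod>j\<in>{1..n}. g j (W j \<omega>)) = (\<Prod>j\<in>{1..n}. expectation (\<lambda>\<omega>. g j (W j \<omega>)))"
  proof (rule indep_vars_lebesgue_integral)
    show "indep_vars (\<lambda>_. borel) (\<lambda>j \<omega>. g j (W j \<omega>)) {1..n}"
      using indep_vars_subset[OF assms(2), of "{1..n}"]
      by (rule indep_vars_compose2) (auto simp: g_def)
    show "integrable M (\<lambda>\<omega>. g j (W j \<omega>))" if "j \<in> {1..n}" for j
      using beta_1_moment(1)[OF assms(1) assms(3)[of j]] that unfolding g_def by simp
  qed auto
  moreover have "expectation (\<lambda>\<omega>. g j (W j \<omega>)) = stick_moment \<theta> (count_list w j) (length (filter (\<lambda>i. j < i) w))"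
    if "j \<in> {1..n}" for j
    using beta_1_moment(2)[OF assms(1) assms(3)[of j]] that unfolding g_def by simp
  ultimately show ?thesis by (simp add: word_weight_def)
qed

section \<open>Samples that are conditionally independent\<close>

text \<open>
  A sample that is conditionally i.i.d. given an arbitrary measurable sequence \<open>P\<close>. No normalisation of \<open>P\<close> is
  assumed; where it matters, the partial sums of \<open>P\<close> are bounded explicitly.
\<close>
locale cond_iid = prob_space M for M :: "'a measure" +
  fixes P :: "nat \<Rightarrow> 'a \<Rightarrow> real" and X :: "nat \<Rightarrow> 'a \<Rightarrow> nat"
  assumes P_measurable: "\<And>i. i \<ge> 1 \<Longrightarrow> P i \<in> borel_measurable M"
    and sample: "cond_iid_sample M P X"
begin

lemma X_measurable_pos: "i \<ge> 1 \<Longrightarrow> X i \<in> M \<rightarrow>\<^sub>M count_space {1..}"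
  using sample unfolding cond_iid_sample_def by blast

lemma X_measurable: "i \<ge> 1 \<Longrightarrow> X i \<in> M \<rightarrow>\<^sub>M count_space UNIV"
  by (rule measurable_compose[OF X_measurable_pos, where g = "\<lambda>x. x"]) auto

lemma X_ge_1: "i \<ge> 1 \<Longrightarrow> \<omega> \<in> space M \<Longrightarrow> X i \<omega> \<ge> 1"
  using measurable_space[OF X_measurable_pos] by simp

text \<open>
  The event \<open>X\<^sub>1 = k\<^sub>1, \<dots>, X\<^sub>n = k\<^sub>n\<close>.
\<close>
definition cylinder :: "nat \<Rightarrow> (nat \<Rightarrow> nat) \<Rightarrow> 'a set" where
  "cylinder n k = {\<omega>\<in>space M. \<forall>i\<in>{1..n}. X i \<omega> = k i}"

lemma cylinder_sets [measurable]: "cylinder n k \<in> sets M"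
proof -
  have "{\<omega>\<in>space M. X i \<omega> = k i} \<in> sets M" if "i \<in> {1..n}" for i
    using measurable_sets[OF X_measurable, of i "{k i}"] that
    by (simp add: vimage_def Int_def conj_commute)
  then show ?thesis unfolding cylinder_def
    by (intro sets.sets_Collect_finite_All) auto
qed

lemma cylinder_prob:
  assumes "k \<in> {1..n} \<rightarrow> {1..}"
  shows "integrable M (\<lambda>\<omega>. \<Prod>i\<in>{1..n}. P (k i) \<omega>)"
    and "prob (cylinder n k) = expectation (\<lambda>\<omega>. \<Prod>i\<in>{1..n}. P (k i) \<omega>)"
proof -
  let ?F = "sigma_of_seq M P"
  have "(\<lambda>\<omega>. \<lambda>i\<in>{1..}. P i \<omega>) \<in> M \<rightarrow>\<^sub>M (\<Pi>\<^sub>M i\<in>{1..}. borel)"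
    by (intro measurable_restrict P_measurable) simp
  then have "subalgebra M ?F"
    by (simp add: measurable_iff_sets subalgebra_def sigma_of_seq_def)
  then interpret F: finite_measure_subalgebra M ?F
    by unfold_locales
  have ae: "AE \<omega> in M. real_cond_exp M ?F (indicator (cylinder n k)) \<omega> = (\<Prod>i\<in>{1..n}. P (k i) \<omega>)"
    using sample assms unfolding cond_iid_sample_def cylinder_def by auto
  have m: "(\<lambda>\<omega>. \<Prod>i\<in>{1..n}. P (k i) \<omega>) \<in> borel_measurable M"
    using assms by (intro borel_measurable_prod P_measurable) auto
  have int: "integrable M (indicator (cylinder n k) :: 'a \<Rightarrow> real)"
    by (rule integrable_real_indicator) (auto simp: emeasure_eq_measure)
  note ce = F.real_cond_exp_int[OF int]
  show "integrable M (\<lambda>\<omega>. \<Prod>i\<in>{1..n}. P (k i) \<omega>)"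
    using ce(1) ae m by (subst integrable_cong_AE[symmetric]) auto
  have "expectation (\<lambda>\<omega>. \<Prod>i\<in>{1..n}. P (k i) \<omega>) = expectation (real_cond_exp M ?F (indicator (cylinder n k)))"
    using ae m by (intro integral_cong_AE) auto
  also have "\<dots> = prob (cylinder n k)"
    using ce(2) by (simp add: cylinder_sets sets.Int_space_eq2)
  finally show "prob (cylinder n k) = expectation (\<lambda>\<omega>. \<Prod>i\<in>{1..n}. P (k i) \<omega>)" ..
qed

text \<open>
  The event that the sample starts with the word \<open>w\<close>.
\<close>
abbreviation word_cylinder :: "nat list \<Rightarrow> 'a set" where
  "word_cylinder w \<equiv> cylinder (length w) (\<lambda>i. w ! (i - 1))"

lemma word_cylinder_prob:
  assumes "set w \<subseteq> {1..}"
  shows "integrable M (\<lambda>\<omega>. \<Prod>i\<leftarrow>w. P i \<omega>)"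
    and "prob (word_cylinder w) = expectation (\<lambda>\<omega>. \<Prod>i\<leftarrow>w. P i \<omega>)"
proof -
  have "(\<Prod>i\<in>{1..length w}. P (w ! (i - 1)) \<omega>) = (\<Prod>i\<leftarrow>w. P i \<omega>)" for \<omega>
  proof -
    have "(\<Prod>i\<leftarrow>w. P i \<omega>) = (\<Prod>i<length w. P (w ! i) \<omega>)"
      by (simp add: prod.list_conv_set_nth atLeast0LessThan)
    also have "\<dots> = (\<Prod>i\<in>{1..length w}. P (w ! (i - 1)) \<omega>)"
      by (rule prod.reindex_bij_witness[of _ "\<lambda>i. i - 1" Suc]) auto
    finally show ?thesis ..
  qed
  moreover have "(\<lambda>i. w ! (i - 1)) \<in> {1..length w} \<rightarrow> {1..}"
    using assms nth_mem[of _ w] by (fastforce simp: subset_iff)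
  note cylinder_prob[OF this]
  ultimately show "integrable M (\<lambda>\<omega>. \<Prod>i\<leftarrow>w. P i \<omega>)"
    "prob (word_cylinder w) = expectation (\<lambda>\<omega>. \<Prod>i\<leftarrow>w. P i \<omega>)" by simp_all
qed

text \<open>
  The event is the cylinder of \<open>w\<close> without the cylinders of the words that prolong \<open>w\<close> by one letter of \<open>[n]\<close>.
\<close>
lemma exhausting_word_prob:
  assumes "set w = {1..n}"
  defines "B \<equiv> {\<omega>\<in>space M. exhausting_word n (\<lambda>i. X i \<omega>) w}"
  shows "B \<in> sets M"
    and "prob B = expectation (\<lambda>\<omega>. (\<Prod>i\<leftarrow>w. P i \<omega>) * (1 - (\<Sum>i\<in>{1..n}. P i \<omega>)))"
proof -
  let ?C = "\<lambda>v. word_cylinder (w @ [v])"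
  have ext: "?C v = {\<omega>\<in>word_cylinder w. X (length w + 1) \<omega> = v}" for v
  proof -
    have "{1..length (w @ [v])} = insert (length w + 1) {1..length w}" by auto
    then show ?thesis by (auto simp: cylinder_def nth_append)
  qed
  have B: "B = word_cylinder w - (\<Union>v\<in>{1..n}. ?C v)"
    unfolding ext using assms(1) by (auto simp: B_def exhausting_word_def cylinder_def)
  then show "B \<in> sets M" by auto
  have int: "integrable M (\<lambda>\<omega>. (\<Prod>i\<leftarrow>w. P i \<omega>) * P v \<omega>)"
    "prob (?C v) = expectation (\<lambda>\<omega>. (\<Prod>i\<leftarrow>w. P i \<omega>) * P v \<omega>)" if "v \<in> {1..n}" for v
    using word_cylinder_prob[of "w @ [v]"] assms(1) that by auto
  have sub: "set w \<subseteq> {1..}" using assms(1) by auto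
  have "(\<Union>v\<in>{1..n}. ?C v) \<subseteq> word_cylinder w"
    unfolding ext by auto
  then have "prob B = prob (word_cylinder w) - prob (\<Union>v\<in>{1..n}. ?C v)"
    unfolding B by (intro finite_measure_Diff) auto
  also have "prob (\<Union>v\<in>{1..n}. ?C v) = (\<Sum>v\<in>{1..n}. prob (?C v))"
  proof (rule finite_measure_finite_Union)
    show "disjoint_family_on ?C {1..n}"
      unfolding ext disjoint_family_on_def by auto
  qed auto
  also have "\<dots> = expectation (\<lambda>\<omega>. \<Sum>v\<in>{1..n}. (\<Prod>i\<leftarrow>w. P i \<omega>) * P v \<omega>)"
    using int by (simp add: Bochner_Integration.integral_sum)
  also have "prob (word_cylinder w) - \<dots> =
      expectation (\<lambda>\<omega>. (\<Prod>i\<leftarrow>w. P i \<omega>) - (\<Sum>v\<in>{1..n}. (\<Prod>i\<leftarrow>w. P i \<omega>) * P v \<omega>))"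
    unfolding word_cylinder_prob(2)[OF sub]
    using int word_cylinder_prob(1)[OF sub]
    by (intro Bochner_Integration.integral_diff[symmetric] Bochner_Integration.integrable_sum) auto
  finally show "prob B = expectation (\<lambda>\<omega>. (\<Prod>i\<leftarrow>w. P i \<omega>) * (1 - (\<Sum>i\<in>{1..n}. P i \<omega>)))"
    by (simp add: right_diff_distrib sum_distrib_left)
qed

lemma prob_sample_le:
  "{\<omega>\<in>space M. \<forall>i\<in>{1..n}. X i \<omega> \<le> m} \<in> sets M"
  "prob {\<omega>\<in>space M. \<forall>i\<in>{1..n}. X i \<omega> \<le> m} = expectation (\<lambda>\<omega>. (\<Sum>v\<in>{1..m}. P v \<omega>) ^ n)"
proof -
  let ?K = "{1..n} \<rightarrow>\<^sub>E {1..m}"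
  have fin: "finite ?K" by (intro finite_PiE) auto
  have "{\<omega>\<in>space M. \<forall>i\<in>{1..n}. X i \<omega> \<le> m} = (\<Union>k\<in>?K. cylinder n k)"
  proof (intro equalityI subsetI)
    fix \<omega> assume "\<omega> \<in> {\<omega>\<in>space M. \<forall>i\<in>{1..n}. X i \<omega> \<le> m}"
    then have "restrict (\<lambda>i. X i \<omega>) {1..n} \<in> ?K" "\<omega> \<in> cylinder n (restrict (\<lambda>i. X i \<omega>) {1..n})"
      using X_ge_1 by (auto simp: cylinder_def)
    then show "\<omega> \<in> (\<Union>k\<in>?K. cylinder n k)" by blast
  qed (auto simp: cylinder_def PiE_iff)
  note eq = this
  show "{\<omega>\<in>space M. \<forall>i\<in>{1..n}. X i \<omega> \<le> m} \<in> sets M"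
    unfolding eq using fin by auto
  have K: "k \<in> {1..n} \<rightarrow> {1..}" if "k \<in> ?K" for k
    using that by (auto simp: PiE_iff)
  have "prob (\<Union>k\<in>?K. cylinder n k) = (\<Sum>k\<in>?K. prob (cylinder n k))"
  proof (rule finite_measure_finite_Union[OF fin])
    show "disjoint_family_on (cylinder n) ?K"
      unfolding disjoint_family_on_def
    proof (intro ballI impI)
      fix k l assume kl: "k \<in> ?K" "l \<in> ?K" "k \<noteq> l"
      then obtain i where "i \<in> {1..n}" "k i \<noteq> l i" by (metis PiE_ext)
      then show "cylinder n k \<inter> cylinder n l = {}" by (fastforce simp: cylinder_def)
    qed
  qed auto
  also have "\<dots> = expectation (\<lambda>\<omega>. \<Sum>k\<in>?K. \<Prod>i\<in>{1..n}. P (k i) \<omega>)"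
    using cylinder_prob[OF K] by (simp add: Bochner_Integration.integral_sum)
  also have "(\<lambda>\<omega>. \<Sum>k\<in>?K. \<Prod>i\<in>{1..n}. P (k i) \<omega>) = (\<lambda>\<omega>. (\<Sum>v\<in>{1..m}. P v \<omega>) ^ n)"
    using prod_sum_PiE[of "{1..n}" "\<lambda>_. {1..m}" "\<lambda>_ v. P v _"] by simp
  finally show "prob {\<omega>\<in>space M. \<forall>i\<in>{1..n}. X i \<omega> \<le> m} = expectation (\<lambda>\<omega>. (\<Sum>v\<in>{1..m}. P v \<omega>) ^ n)"
    unfolding eq .
qed

text \<open>
  The probability that the first \<open>n\<close> values are all at most \<open>m\<close> is the expectation of the \<open>n\<close>-th power of a variable
  in \<open>[0, 1)\<close>, which tends to \<open>0\<close> by dominated convergence.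
\<close>
lemma AE_sample_unbounded:
  assumes "AE \<omega> in M. \<forall>m. 0 \<le> (\<Sum>v\<in>{1..m}. P v \<omega>) \<and> (\<Sum>v\<in>{1..m}. P v \<omega>) < 1"
  shows "AE \<omega> in M. \<forall>m. \<exists>i\<ge>1. X i \<omega> > m"
  unfolding AE_all_countable
proof
  fix m
  let ?S = "\<lambda>\<omega>. \<Sum>v\<in>{1..m}. P v \<omega>"
  let ?E = "\<lambda>n. {\<omega>\<in>space M. \<forall>i\<in>{1..n}. X i \<omega> \<le> m}"
  have meas: "?S \<in> borel_measurable M"
    by (intro borel_measurable_sum P_measurable) auto
  have "(\<lambda>n. expectation (\<lambda>\<omega>. ?S \<omega> ^ n)) \<longlonglongrightarrow> expectation (\<lambda>\<omega>. 0)"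
  proof (rule integral_dominated_convergence[where w = "\<lambda>_. 1"])
    show "AE \<omega> in M. (\<lambda>n. ?S \<omega> ^ n) \<longlonglongrightarrow> 0"
      using assms by eventually_elim (simp add: LIMSEQ_realpow_zero)
    show "AE \<omega> in M. norm (?S \<omega> ^ n) \<le> 1" for n
      using assms by eventually_elim (simp add: power_abs power_le_one less_imp_le)
  qed (use meas in auto)
  then have lim: "(\<lambda>n. prob (?E n)) \<longlonglongrightarrow> 0" unfolding prob_sample_le(2) by (simp only: Bochner_Integration.integral_zero)
  have E: "(\<Inter>n. ?E n) \<in> sets M" using prob_sample_le(1) by auto
  have "prob (\<Inter>n. ?E n) \<le> 0"
    using lim by (rule LIMSEQ_le_const)
      (use prob_sample_le(1) in \<open>auto intro!: finite_measure_mono\<close>)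
  then have "(\<Inter>n. ?E n) \<in> null_sets M"
    using E by (auto simp: null_sets_def emeasure_eq_measure measure_le_0_iff)
  then show "AE \<omega> in M. \<exists>i\<ge>1. X i \<omega> > m"
    by (rule AE_I') (auto simp: not_less)
qed

lemma sets_infinite_first_appearance_times:
  "{\<omega>\<in>space M. infinite (first_appearance_times (\<lambda>i. X i \<omega>))} \<in> sets M"
proof -
  define Y where "Y i = X (Suc i)" for i
  have Y: "Y i \<in> M \<rightarrow>\<^sub>M count_space UNIV" for i
    unfolding Y_def by (rule X_measurable) simp
  \<comment> \<open>The index shift makes every \<open>Y i\<close> measurable; nothing is known of \<open>X 0\<close>.\<close>
  have "infinite (first_appearance_times (\<lambda>i. X i \<omega>)) \<longleftrightarrow>
      (\<forall>m. \<exists>i. m \<le> i \<and> 1 \<le> i \<and> (\<forall>j\<in>{1..<i}. Y (j - 1) \<omega> \<noteq> Y (i - 1) \<omega>))" for \<omega>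
    by (auto simp: infinite_nat_iff_unbounded_le first_appearance_times_def Y_def)
  moreover have "{\<omega>\<in>space M. \<forall>m. \<exists>i. m \<le> i \<and> 1 \<le> i \<and> (\<forall>j\<in>{1..<i}. Y (j - 1) \<omega> \<noteq> Y (i - 1) \<omega>)} \<in> sets M"
  proof (intro sets.sets_Collect_countable_All sets.sets_Collect_countable_Ex sets.sets_Collect_conj
      sets.sets_Collect_const sets.sets_Collect_finite_All)
    fix i j
    have "{\<omega>\<in>space M. Y (j - 1) \<omega> = Y (i - 1) \<omega>}
        = (\<Union>c. (Y (j - 1) -` {c} \<inter> space M) \<inter> (Y (i - 1) -` {c} \<inter> space M))"
      by auto
    also have "\<dots> \<in> sets M"
      using measurable_sets[OF Y] by (intro sets.countable_UN) auto
    finally show "{\<omega>\<in>space M. Y (j - 1) \<omega> \<noteq> Y (i - 1) \<omega>} \<in> sets M"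
      by (rule sets.sets_Collect_neg)
  qed simp
  ultimately show ?thesis by (simp only:)
qed

lemma prob_distinct_value_onto:
  assumes inf: "AE \<omega> in M. infinite (first_appearance_times (\<lambda>i. X i \<omega>))"
  shows "ennreal (prob {\<omega>\<in>space M. distinct_value (\<lambda>i. X i \<omega>) ` {1..n} = {1..n}})
    = (\<integral>\<^sup>+w. ennreal (expectation (\<lambda>\<omega>. (\<Prod>i\<leftarrow>w. P i \<omega>) * (1 - (\<Sum>i\<in>{1..n}. P i \<omega>)))) \<partial>count_space {w. set w = {1..n}})"
proof -
  let ?A = "{\<omega>\<in>space M. distinct_value (\<lambda>i. X i \<omega>) ` {1..n} = {1..n}}"
  define B where "B w = {\<omega>\<in>space M. exhausting_word n (\<lambda>i. X i \<omega>) w}" for w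
  let ?I = "{w. set w = {1..n}}"
  have B: "B w \<in> sets M" if "w \<in> ?I" for w
    using exhausting_word_prob(1)[of w n] that by (simp add: B_def)
  have count: "countable ?I" by (rule countableI_type)
  have U: "(\<Union>w\<in>?I. B w) \<in> sets M" using count B by (intro sets.countable_UN') auto
  have iff: "distinct_value (\<lambda>i. X i \<omega>) ` {1..n} = {1..n} \<longleftrightarrow> \<omega> \<in> (\<Union>w\<in>?I. B w)"
    if "\<omega> \<in> space M" "infinite (first_appearance_times (\<lambda>i. X i \<omega>))" for \<omega>
    using distinct_value_onto_iff[OF that(2), of n] that(1) by (auto simp: B_def exhausting_word_def)
  \<comment> \<open>For \<open>n = 0\<close> the event is the whole space. Otherwise it excludes the sequences with finitely many
      values, for which the dummy value \<open>0\<close> is used.\<close>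
  have A: "?A \<in> sets M"
  proof (cases "n = 0")
    case False
    then have n: "1 \<in> {1..n}" by simp
    have "infinite (first_appearance_times x)" if "distinct_value x ` {1..n} = {1..n}" for x
    proof
      assume "finite (first_appearance_times x)"
      then have "distinct_value x ` {1..n} \<subseteq> {0}" by (auto simp: distinct_value_def)
      then have "1 \<in> {0::nat}" using n unfolding that by blast
      then show False by simp
    qed
    then have "?A = (\<Union>w\<in>?I. B w) \<inter> {\<omega>\<in>space M. infinite (first_appearance_times (\<lambda>i. X i \<omega>))}"
      using iff by (intro set_eqI) (metis (mono_tags, lifting) Int_iff mem_Collect_eq)
    then show ?thesis using U sets_infinite_first_appearance_times by auto
  qed simp
  have "prob ?A = prob (\<Union>w\<in>?I. B w)"
  proof (rule measure_eq_AE[OF _ A U])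
    show "AE \<omega> in M. \<omega> \<in> ?A \<longleftrightarrow> \<omega> \<in> (\<Union>w\<in>?I. B w)"
      using inf AE_space
    proof eventually_elim
      case (elim \<omega>)
      then show ?case using iff[of \<omega>] by (simp only: mem_Collect_eq simp_thms)
    qed
  qed
  then have "ennreal (prob ?A) = emeasure M (\<Union>w\<in>?I. B w)"
    by (simp add: emeasure_eq_measure)
  also have "\<dots> = (\<integral>\<^sup>+w. emeasure M (B w) \<partial>count_space ?I)"
  proof (intro emeasure_UN_countable B count)
    show "disjoint_family_on B ?I"
      unfolding disjoint_family_on_def B_def by (blast dest: exhausting_word_unique)
  qed
  also have "\<dots> = (\<integral>\<^sup>+w. ennreal (expectation (\<lambda>\<omega>. (\<Prod>i\<leftarrow>w. P i \<omega>) * (1 - (\<Sum>i\<in>{1..n}. P i \<omega>)))) \<partial>count_space ?I)"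
    by (intro nn_integral_cong) (simp only: space_count_space mem_Collect_eq emeasure_eq_measure B_def exhausting_word_prob(2))
  finally show ?thesis .
qed

end

section \<open>The limit for GEM weights\<close>

lemma prob_maps_onto_eq_strict_prob:
  assumes "prob_space M" "\<theta> > 0"
    and indep: "prob_space.indep_vars M (\<lambda>_. borel) W {1..}"
    and beta: "\<And>i. i \<ge> 1 \<Longrightarrow> distributed M lborel (W i) (beta_1_density \<theta>)"
    and perm: "biased_permutation M (stick_breaking W) Perm"
  shows "prob_maps_onto M Perm n = enn2real (strict_prob \<theta> n 0)"
proof -
  interpret prob_space M by fact
  obtain X where X: "cond_iid_sample M (stick_breaking W) X"
    and Perm: "\<And>i \<omega>. i \<ge> 1 \<Longrightarrow> \<omega> \<in> space M \<Longrightarrow> Perm i \<omega> = distinct_value (\<lambda>j. X j \<omega>) i"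
    using perm by (auto simp: biased_permutation_def)
  have W: "W i \<in> borel_measurable M" if "i \<ge> 1" for i
    using distributed_measurable[OF beta[OF that]] by simp
  interpret cond_iid M "stick_breaking W" X
  proof
    show "stick_breaking W i \<in> borel_measurable M" if "i \<ge> 1" for i
      unfolding stick_breaking_def using that
      by (intro borel_measurable_times borel_measurable_prod borel_measurable_diff borel_measurable_const W) auto
  qed fact
  have "AE \<omega> in M. \<forall>i. i \<ge> 1 \<longrightarrow> 0 < W i \<omega> \<and> W i \<omega> < 1"
    unfolding AE_all_countable using beta_1_AE[OF beta] by (auto simp: AE_all_countable)
  then have "AE \<omega> in M. \<forall>m. 0 \<le> (\<Sum>v\<in>{1..m}. stick_breaking W v \<omega>) \<and> (\<Sum>v\<in>{1..m}. stick_breaking W v \<omega>) < 1"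
  proof eventually_elim
    case (elim \<omega>)
    show ?case
    proof
      fix m
      have "(\<Prod>j\<in>{1..m}. 1 - W j \<omega>) > 0" using elim by (intro prod_pos) auto
      moreover have "(\<Prod>j\<in>{1..m}. 1 - W j \<omega>) \<le> 1" using elim by (intro prod_le_1) (auto simp: less_imp_le)
      ultimately show "0 \<le> (\<Sum>v\<in>{1..m}. stick_breaking W v \<omega>) \<and> (\<Sum>v\<in>{1..m}. stick_breaking W v \<omega>) < 1"
        using stick_breaking_remainder[of W \<omega> m] by linarith
    qed
  qed
  from AE_sample_unbounded[OF this]
  have inf: "AE \<omega> in M. infinite (first_appearance_times (\<lambda>i. X i \<omega>))"
    by eventually_elim (rule infinite_first_appearance_times, blast)
  have "(\<lambda>i. Perm i \<omega>) ` {1..n} = distinct_value (\<lambda>i. X i \<omega>) ` {1..n}" if "\<omega> \<in> space M" for \<omega>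
    using Perm that by (intro image_cong) auto
  then have "{\<omega>\<in>space M. (\<lambda>i. Perm i \<omega>) ` {1..n} = {1..n}} = {\<omega>\<in>space M. distinct_value (\<lambda>i. X i \<omega>) ` {1..n} = {1..n}}"
    by auto
  then have "ennreal (prob_maps_onto M Perm n)
      = (\<integral>\<^sup>+w. ennreal (expectation (\<lambda>\<omega>. (\<Prod>i\<leftarrow>w. stick_breaking W i \<omega>) * (1 - (\<Sum>i\<in>{1..n}. stick_breaking W i \<omega>)))) \<partial>count_space {w. set w = {1..n}})"
    unfolding prob_maps_onto_def using prob_distinct_value_onto[OF inf, of n] by simp
  also have "\<dots> = (\<integral>\<^sup>+w. ennreal (word_weight \<theta> n w) \<partial>count_space {w. set w = {1..n}})"
    using stick_breaking_word_expectation[OF assms(2) indep beta] by (intro nn_integral_cong) simp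
  also have "\<dots> = strict_prob \<theta> n 0"
    by (rule word_weight_total[OF assms(2)])
  finally have "enn2real (ennreal (prob_maps_onto M Perm n)) = enn2real (strict_prob \<theta> n 0)"
    by simp
  then show ?thesis by (simp add: prob_maps_onto_def)
qed

theorem mainTheorem4:
  fixes M :: "'a measure" and \<theta> :: real
    and W :: "nat \<Rightarrow> 'a \<Rightarrow> real" and Perm :: "nat \<Rightarrow> 'a \<Rightarrow> nat"
  assumes "prob_space M"
    and "\<theta> > 0"
    and "prob_space.indep_vars M (\<lambda>_. borel) W {1..}"
    and "\<And>i. i \<ge> 1 \<Longrightarrow> distributed M lborel (W i) (beta_1_density \<theta>)"
    and "biased_permutation M (stick_breaking W) Perm"
  shows "convergent (prob_maps_onto M Perm)
    \<and> convergent_prod (\<lambda>j. real (j + 2) * (real (j + 2) + 2 * \<theta>) / (real (j + 2) + \<theta>)\<^sup>2)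
    \<and> lim (prob_maps_onto M Perm) =
        1 / (1 + \<theta>) * (\<Prod>j. real (j + 2) * (real (j + 2) + 2 * \<theta>) / (real (j + 2) + \<theta>)\<^sup>2)
    \<and> lim (prob_maps_onto M Perm) = Gamma (\<theta> + 2) * Gamma (\<theta> + 1) / Gamma (2 * \<theta> + 2)
    \<and> (\<theta> = 1 \<longrightarrow> lim (prob_maps_onto M Perm) = 1 / 3)"
proof -
  have "prob_maps_onto M Perm = (\<lambda>n. enn2real (strict_prob \<theta> n 0))"
    using prob_maps_onto_eq_strict_prob[OF assms] by auto
  then have lim: "prob_maps_onto M Perm \<longlonglongrightarrow> strict_limit \<theta> 0"
    using strict_prob_tendsto[OF assms(2), of 0] by simp
  have closed: "strict_limit \<theta> 0 = Gamma (\<theta> + 2) * Gamma (\<theta> + 1) / Gamma (2 * \<theta> + 2)"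
    by (simp add: strict_limit_def add_ac mult_ac)
  have one: "strict_limit \<theta> 0 = 1 / 3" if "\<theta> = 1"
  proof -
    have "Gamma (4::real) = 6" "Gamma (3::real) = 2" "Gamma (2::real) = 1"
      using Gamma_fact[of 3, where ?'a = real] Gamma_fact[of 2, where ?'a = real] Gamma_fact[of 1, where ?'a = real]
      by (simp_all add: fact_numeral)
    then show ?thesis using closed that by simp
  qed
  show ?thesis
    using lim limI[OF lim] strict_limit_infinite_product[OF assms(2)] closed one
    by (auto simp: convergent_def)
qed

end
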